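(* Let $\mathcal{Y}$ be a set of $K$ classes, let $P(\cdot\,|\,\boldsymbol{x})$ be a probability distribution on $\mathcal{Y}$, and let $u$ be the set-based utility function determined by a decreasing sequence $(g(1),\dots,g(K))\in[0,1]^K$. Then the exact solution of the expected utility maximization problem $$\hat Y_u^{*}(\boldsymbol{x})=\arg\max_{\hat Y\in 2^{\mathcal{Y}}\setminus\{\emptyset\}} U(\hat Y,P,u)$$ can be computed by analyzing only $K$ subsets of $\mathcal{Y}$.
   Context: $\mathcal{Y}=\{c_1,\dots,c_K\}$ is a finite set of $K$ classes. For a fixed instance $\boldsymbol{x}$, $P(\cdot\,|\,\boldsymbol{x})$ is a probability distribution on $\mathcal{Y}$: $0\le P(c\,|\,\boldsymbol{x})\le 1$ for all $c \in \mathcal{Y}$ and $\sum_{c\in\mathcal{Y}}P(c\,|\,\boldsymbol{x})=1$. Given a decreasing sequence $(g(1),\dots,g(K))\in[0,1]^K$ (decreasing in the non-strict sense; constant sequences are allowed), the associated set-based utility function $u:\mathcal{Y}\times(2^{\mathcal{Y}}\setminus\{\emptyset\})\to[0,1]$ is $$u(c,\hat Y)=\begin{cases}0 & \text{if } c\notin\hat Y,\\ g(|\hat Y|) & \text{if } c\in\hat Y,\end{cases}$$ where $|\hat Y|$ is the cardinality of $\hat Y$. The expected utility of a non-empty set $\hat Y\subseteq\mathcal{Y}$ is $U(\hat Y,P,u)=\sum_{c\in\mathcal{Y}}u(c,\hat Y)\,P(c\,|\,\boldsymbol{x})$. *)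

theory Defs
  imports Complex_Main
begin

definition class_distribution :: "'c set \<Rightarrow> ('c \<Rightarrow> real) \<Rightarrow> bool" where
  "class_distribution Y P \<longleftrightarrow> (\<forall>c\<in>Y. 0 \<le> P c \<and> P c \<le> 1) \<and> (\<Sum>c\<in>Y. P c) = 1"

definition utility_sequence :: "nat \<Rightarrow> (nat \<Rightarrow> real) \<Rightarrow> bool" where
  "utility_sequence K g \<longleftrightarrow> antimono_on {1..K} g \<and> g ` {1..K} \<subseteq> {0..1}"

definition set_utility :: "(nat \<Rightarrow> real) \<Rightarrow> 'c \<Rightarrow> 'c set \<Rightarrow> real" where
  "set_utility g c S = (if c \<in> S then g (card S) else 0)"

definition expected_utility ::
    "'c set \<Rightarrow> ('c \<Rightarrow> real) \<Rightarrow> ('c \<Rightarrow> 'c set \<Rightarrow> real) \<Rightarrow> 'c set \<Rightarrow> real" where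
  "expected_utility Y P u S = (\<Sum>c\<in>Y. u c S * P c)"

definition exact_solution ::
    "'c set \<Rightarrow> ('c \<Rightarrow> real) \<Rightarrow> ('c \<Rightarrow> 'c set \<Rightarrow> real) \<Rightarrow> 'c set \<Rightarrow> bool" where
  "exact_solution Y P u S \<longleftrightarrow>
     is_arg_max (expected_utility Y P u) (\<lambda>T. T \<in> Pow Y - {{}}) S"

text \<open>
  A deterministic, adaptive search procedure.  Analyzing a subset means evaluating its expected
  utility, and this is the only access to the utility function.  The class probabilities are
  otherwise visible only through comparisons of two classes, so that a continuation, being an
  arbitrary function, cannot hide an optimization over subsets that are not analyzed.
\<close>

datatype 'c procedure =
    Return "'c set"
  | Compare 'c 'c "bool \<Rightarrow> 'c procedure"
  | Analyze "'c set" "real \<Rightarrow> 'c procedure"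

primrec result :: "('c \<Rightarrow> real) \<Rightarrow> ('c set \<Rightarrow> real) \<Rightarrow> 'c procedure \<Rightarrow> 'c set" where
  "result P U (Return S) = S"
| "result P U (Compare a b k) = result P U (k (P a \<le> P b))"
| "result P U (Analyze S k) = result P U (k (U S))"

primrec analyzed :: "('c \<Rightarrow> real) \<Rightarrow> ('c set \<Rightarrow> real) \<Rightarrow> 'c procedure \<Rightarrow> 'c set set" where
  "analyzed P U (Return S) = {}"
| "analyzed P U (Compare a b k) = analyzed P U (k (P a \<le> P b))"
| "analyzed P U (Analyze S k) = insert S (analyzed P U (k (U S)))"

end

theory Submission
  imports Defs
begin

text \<open>
  Among the sets of a fixed size \<open>k\<close> the factor \<open>g k\<close> is constant, so the expected utility is
  maximized by a set of \<open>k\<close> most probable classes.  After sorting the classes by decreasing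
  probability, which needs only comparisons, the \<open>K\<close> prefixes of the sorted list are therefore the
  only candidates.
\<close>

text \<open>Continuation-passing style: a \<open>procedure\<close> can only return a set, so a list
  built from the outcomes of comparisons reaches the later stages through \<open>k\<close>.\<close>

primrec insert_class :: "'c \<Rightarrow> 'c list \<Rightarrow> ('c list \<Rightarrow> 'c procedure) \<Rightarrow> 'c procedure" where
  "insert_class x [] k = k [x]"
| "insert_class x (y # ys) k =
     Compare y x (\<lambda>b. if b then k (x # y # ys) else insert_class x ys (\<lambda>zs. k (y # zs)))"

primrec sort_classes :: "'c list \<Rightarrow> ('c list \<Rightarrow> 'c procedure) \<Rightarrow> 'c procedure" where
  "sort_classes [] k = k []"
| "sort_classes (x # xs) k = sort_classes xs (\<lambda>ys. insert_class x ys k)"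

text \<open>\<open>B\<close> is the incumbent and \<open>v\<close> its utility, carried along so
  that \<open>B\<close> is not analyzed again.\<close>

primrec best_of :: "'c set list \<Rightarrow> 'c set \<Rightarrow> real \<Rightarrow> 'c procedure" where
  "best_of [] B v = Return B"
| "best_of (S # Ss) B v = Analyze S (\<lambda>w. if v < w then best_of Ss S w else best_of Ss B v)"

text \<open>The full set is analyzed first and serves as the initial incumbent; hence the range of
  \<open>k\<close> stops short of \<open>length ys\<close>, and it starts at 1 to skip the empty
  set.\<close>

definition best_prefix :: "'c list \<Rightarrow> 'c procedure" where
  "best_prefix ys =
     Analyze (set ys) (best_of (map (\<lambda>k. set (take k ys)) [1..<length ys]) (set ys))"

text \<open>With the key \<open>- P c\<close>, the test made by \<open>insort_key\<close> is
  \<open>P y \<le> P x\<close>, exactly the outcome of \<open>Compare y x\<close>, ties included. No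
  \<open>Analyze\<close> node is met before \<open>k\<close> takes over, so sorting adds no analyzed
  set.\<close>

lemma insert_class_eq_insort_key:
  "result P U (insert_class x ys k) = result P U (k (insort_key (\<lambda>c. - P c) x ys))"
  "analyzed P U (insert_class x ys k) = analyzed P U (k (insort_key (\<lambda>c. - P c) x ys))"
  by (induction ys arbitrary: k) auto

lemma sort_classes_eq_sort_key:
  "result P U (sort_classes xs k) = result P U (k (sort_key (\<lambda>c. - P c) xs))"
  "analyzed P U (sort_classes xs k) = analyzed P U (k (sort_key (\<lambda>c. - P c) xs))"
  by (induction xs arbitrary: k) (auto simp: insert_class_eq_insort_key)

text \<open>Both branches go on with the same remaining list, so the utilities found do not
  influence which sets are analyzed.\<close>

lemma analyzed_best_of: "analyzed P U (best_of Ss B v) = set Ss"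
  by (induction Ss arbitrary: B v) auto

lemma result_best_of_in: "result P U (best_of Ss B v) \<in> insert B (set Ss)"
proof (induction Ss arbitrary: B v)
  case (Cons S Ss)
  show ?case using Cons[of S "U S"] Cons[of B v] by auto
qed simp

lemma result_best_of_ge:
  assumes "T \<in> insert B (set Ss)"
  shows "U T \<le> U (result P U (best_of Ss B (U B)))"
  using assms
proof (induction Ss arbitrary: B T)
  case (Cons S Ss)
  show ?case
  proof (cases "U B < U S")
    case True
    \<comment> \<open>The second instance bounds the new incumbent; by transitivity it covers the
      case that \<open>T\<close> is the set just discarded.\<close>
    then show ?thesis using Cons.IH[of T S] Cons.IH[of S S] Cons.prems by auto
  next
    case False
    then show ?thesis using Cons.IH[of T B] Cons.IH[of B B] Cons.prems by auto
  qed
qed simp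

lemma prefixes_eq:
  assumes "ys \<noteq> []"
  shows "insert (set ys) (set (map (\<lambda>k. set (take k ys)) [1..<length ys])) =
    (\<lambda>k. set (take k ys)) ` {1..length ys}"
proof -
  have "{1..length ys} = insert (length ys) {1..<length ys}"
    using assms by (auto simp: Suc_le_eq)
  then show ?thesis by simp
qed

lemma analyzed_best_prefix:
  assumes "ys \<noteq> []"
  shows "analyzed P U (best_prefix ys) = (\<lambda>k. set (take k ys)) ` {1..length ys}"
  using prefixes_eq[OF assms] by (simp add: best_prefix_def analyzed_best_of)

lemma result_best_prefix_in:
  assumes "ys \<noteq> []"
  shows "result P U (best_prefix ys) \<in> (\<lambda>k. set (take k ys)) ` {1..length ys}"
  using prefixes_eq[OF assms] result_best_of_in by (metis best_prefix_def result.simps(3))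

lemma result_best_prefix_ge:
  assumes "k \<in> {1..length ys}"
  shows "U (set (take k ys)) \<le> U (result P U (best_prefix ys))"
proof -
  have "ys \<noteq> []" using assms by auto
  then have "set (take k ys) \<in>
      insert (set ys) (set (map (\<lambda>k. set (take k ys)) [1..<length ys]))"
    using assms by (subst prefixes_eq) auto
  then show ?thesis unfolding best_prefix_def by (simp only: result.simps result_best_of_ge)
qed

text \<open>Exchange argument: after removing the common part, \<open>T - A\<close> and
  \<open>A - T\<close> have equal size, and each class of the prefix \<open>A\<close> is at least as
  probable as each class outside it, so a bijection compares the two sums term by term.\<close>

lemma sum_le_sum_prefix:
  fixes P :: "'c \<Rightarrow> real"
  assumes "distinct ys" and "sorted (map (\<lambda>c. - P c) ys)" and T: "T \<subseteq> set ys"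
  shows "sum P T \<le> sum P (set (take (card T) ys))"
proof -
  define A where "A = set (take (card T) ys)"
  have fin: "finite A" "finite T"
    using T by (auto simp: A_def intro: finite_subset)
  have "card T \<le> length ys"
    using card_mono[OF _ T] card_length[of ys] by simp
  then have "card A = card T"
    using assms(1) by (simp add: A_def distinct_card)
  then have "card (T - A) = card (A - T)"
    using fin card_Diff_subset_Int[of T A] card_Diff_subset_Int[of A T]
    by (simp add: Int_commute)
  then obtain h where h: "bij_betw h (T - A) (A - T)"
    using fin finite_same_card_bij by blast
  have "set ys = A \<union> set (drop (card T) ys)"
    unfolding A_def by (metis append_take_drop_id set_append)
  then have drop: "T - A \<subseteq> set (drop (card T) ys)"
    using T by auto
  \<comment> \<open>Cutting the sorted list at position \<open>card T\<close> puts every key in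
    \<open>A\<close> below every key in the rest, which contains \<open>T - A\<close>.\<close>
  have "sorted (map (\<lambda>c. - P c) (take (card T) ys) @ map (\<lambda>c. - P c) (drop (card T) ys))"
    using assms(2) by (metis append_take_drop_id map_append)
  then have "P b \<le> P a" if "a \<in> A" "b \<in> T - A" for a b
    using that drop by (auto simp: sorted_append A_def)
  moreover have "h b \<in> A" if "b \<in> T - A" for b
    using h that by (auto simp: bij_betw_def)
  ultimately have "sum P (T - A) \<le> (\<Sum>b\<in>T - A. P (h b))"
    by (intro sum_mono) blast
  also have "\<dots> = sum P (A - T)"
    using sum.reindex_bij_betw[OF h] .
  finally have "sum P (T - A) \<le> sum P (A - T)" .
  then show ?thesis
    using sum.Int_Diff[OF fin(2), of P A] sum.Int_Diff[OF fin(1), of P T]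
    by (simp add: A_def Int_commute)
qed

lemma expected_utility_set_utility:
  assumes "finite Y" and "S \<subseteq> Y"
  shows "expected_utility Y P (set_utility g) S = g (card S) * sum P S"
proof -
  have "expected_utility Y P (set_utility g) S = (\<Sum>c\<in>Y. if c \<in> S then g (card S) * P c else 0)"
    unfolding expected_utility_def set_utility_def by (intro sum.cong) auto
  also have "\<dots> = (\<Sum>c\<in>S. g (card S) * P c)"
    using assms by (simp add: sum.If_cases Int_absorb1)
  finally show ?thesis by (simp add: sum_distrib_left)
qed

text \<open>Both sets have \<open>card T\<close> elements and hence the same factor
  \<open>g (card T)\<close>; being nonnegative, it preserves the inequality between the probability
  sums.\<close>

lemma expected_utility_le_prefix:
  assumes "distinct ys" and "sorted (map (\<lambda>c. - P c) ys)"
    and "T \<subseteq> set ys" and "0 \<le> g (card T)"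
  shows "expected_utility (set ys) P (set_utility g) T
    \<le> expected_utility (set ys) P (set_utility g) (set (take (card T) ys))"
proof -
  have "card T \<le> length ys"
    using card_mono[OF _ assms(3)] card_length[of ys] by simp
  then have "card (set (take (card T) ys)) = card T"
    using assms(1) by (simp add: distinct_card)
  then show ?thesis
    using assms by (simp add: expected_utility_set_utility set_take_subset
        mult_left_mono sum_le_sum_prefix)
qed

text \<open>The cardinality of a prefix recovers its length, so different lengths give different
  sets. This makes the count of analyzed sets exact, not just an upper bound.\<close>

lemma card_prefixes:
  assumes "distinct ys"
  shows "card ((\<lambda>k. set (take k ys)) ` {1..length ys}) = length ys"
proof -
  have "card (set (take k ys)) = k" if "k \<in> {1..length ys}" for k
    using that assms by (simp add: distinct_card)
  then have "inj_on (\<lambda>k. set (take k ys)) {1..length ys}"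
    by (metis (mono_tags, lifting) inj_onI)
  then show ?thesis by (simp add: card_image)
qed

lemma best_prefix_correct:
  fixes P :: "'c \<Rightarrow> real" and g :: "nat \<Rightarrow> real"
  assumes "distinct ys" and "sorted (map (\<lambda>c. - P c) ys)" and "ys \<noteq> []"
    and g: "\<And>k. k \<in> {1..length ys} \<Longrightarrow> 0 \<le> g k"
  defines "U \<equiv> expected_utility (set ys) P (set_utility g)"
  shows "exact_solution (set ys) P (set_utility g) (result P U (best_prefix ys))"
    and "analyzed P U (best_prefix ys) \<subseteq> Pow (set ys) - {{}}"
    and "card (analyzed P U (best_prefix ys)) = length ys"
proof -
  have prefixes: "(\<lambda>k. set (take k ys)) ` {1..length ys} \<subseteq> Pow (set ys) - {{}}"
    using assms(3) by (auto dest: in_set_takeD)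
  have "U T \<le> U (result P U (best_prefix ys))" if "T \<subseteq> set ys" "T \<noteq> {}" for T
  proof -
    have "finite T" using that(1) by (rule finite_subset) simp
    then have card: "card T \<in> {1..length ys}"
      using that card_mono[OF _ that(1)] card_length[of ys] by (simp add: Suc_le_eq card_gt_0_iff)
    have "U T \<le> U (set (take (card T) ys))"
      unfolding U_def using assms(1,2) that(1) g[OF card] by (rule expected_utility_le_prefix)
    also have "\<dots> \<le> U (result P U (best_prefix ys))"
      using card by (rule result_best_prefix_ge)
    finally show ?thesis .
  qed
  \<comment> \<open>\<open>is_arg_max\<close> asks for feasibility, which holds because the result
    is itself a prefix, and for the absence of a strictly better set.\<close>
  then show "exact_solution (set ys) P (set_utility g) (result P U (best_prefix ys))"
    using prefixes result_best_prefix_in[OF assms(3), of P U]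
    unfolding exact_solution_def is_arg_max_def U_def[symmetric] by (auto simp: not_less)
  show "analyzed P U (best_prefix ys) \<subseteq> Pow (set ys) - {{}}"
    using prefixes assms(3) by (simp add: analyzed_best_prefix)
  show "card (analyzed P U (best_prefix ys)) = length ys"
    by (simp only: analyzed_best_prefix[OF assms(3)] card_prefixes[OF assms(1)])
qed

theorem theorem1:
  shows "\<exists>algorithm :: 'c list \<Rightarrow> 'c procedure.
    \<forall>(Y :: 'c set) (K :: nat) (cs :: 'c list) (P :: 'c \<Rightarrow> real) (g :: nat \<Rightarrow> real).
      finite Y \<and> card Y = K \<and> distinct cs \<and> set cs = Y \<and>
      class_distribution Y P \<and> utility_sequence K g \<longrightarrow>
      (let U = expected_utility Y P (set_utility g);
           A = analyzed P U (algorithm cs)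
       in exact_solution Y P (set_utility g) (result P U (algorithm cs)) \<and>
          A \<subseteq> Pow Y - {{}} \<and> card A = K)"
proof (intro exI[of _ "\<lambda>cs. sort_classes cs best_prefix"] allI impI, elim conjE)
  fix Y :: "'c set" and K cs and P :: "'c \<Rightarrow> real" and g
  assume K: "card Y = K" and cs: "distinct cs" "set cs = Y"
    and P: "class_distribution Y P" and g: "utility_sequence K g"
  define ys where "ys = sort_key (\<lambda>c. - P c) cs"
  have ys: "distinct ys" "sorted (map (\<lambda>c. - P c) ys)" "set ys = Y"
    using cs by (simp_all add: ys_def)
  have len: "length ys = K"
    using ys(1,3) K by (simp add: distinct_card[symmetric])
  \<comment> \<open>The probabilities sum to 1, whereas an empty sum is 0.\<close>
  have "ys \<noteq> []"
    using P ys(3) by (auto simp: class_distribution_def)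
  moreover have "0 \<le> g k" if "k \<in> {1..length ys}" for k
    using g that len by (force simp: utility_sequence_def image_subset_iff)
  ultimately show "let U = expected_utility Y P (set_utility g);
           A = analyzed P U (sort_classes cs best_prefix)
       in exact_solution Y P (set_utility g) (result P U (sort_classes cs best_prefix)) \<and>
          A \<subseteq> Pow Y - {{}} \<and> card A = K"
    using best_prefix_correct[of ys P g] ys len
    by (simp add: Let_def sort_classes_eq_sort_key ys_def[symmetric])
qed

end
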